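(* Let $n,k,r$ be positive integers and $p,b$ non-negative integers with $r\le p+1$. Put $$D(n,k,r,b,p)=\det\left(\binom{(n-i+1)p+b-i+j+k+(i-1)r}{k+(i-1)r}\right)_{1\le i,j\le n+1}.$$ Then $$D(n,k,r,b,p)=\prod_{(i,j)\in\mathcal{A}_{n,k,r}}\frac{i+b+jp}{i}\ \prod_{(i,j)\in\mathcal{B}_{n,k,r}}\frac{(k-i+1)(p+1)+(i+j-1)r+r(b+np)}{k-i+1+(i+j-1)r},$$ where $$\mathcal{A}_{n,k,r}=\{(i,j)\in\mathbb{Z}_{\ge0}^2\ |\ j\le n,\ j<i\le k+(r-1)(n-j)\},$$ $$\mathcal{B}_{n,k,r}=\{(i,j)\in\mathbb{Z}_{\ge1}^2\ |\ i+j\le n+1,\ i\ne k+1+rs\ \text{for all}\ s\in\mathbb{Z}_{\ge0}\}.$$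
   Context: Binomial coefficients $\binom{a}{c}$ with $0\le a<c$ are zero. (The number $D(n,k,r,b,p)$ is the value at $x_1=x_2=\cdots=1$ of the Schubert polynomial of the unique vexillary permutation with shape $\lambda_i=(n-i+1)p+b$ and flag $\phi_i=k+1+r(i-1)$, $1\le i\le n+1-\delta_{b,0}$.) *)

theory Defs
  imports "Jordan_Normal_Form.Determinant"
begin

text \<open>
  The upper index is arranged so that the only subtraction that could truncate, the final
  \<open>- i\<close>, does not do so in the relevant range; see \<open>D_upper_int\<close> below.
\<close>
definition D_upper :: "nat \<Rightarrow> nat \<Rightarrow> nat \<Rightarrow> nat \<Rightarrow> nat \<Rightarrow> nat \<Rightarrow> nat \<Rightarrow> nat" where
  "D_upper n k r b p i j = ((n + 1 - i) * p + b + j + k + (i - 1) * r) - i"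

lemma D_upper_int:
  assumes "1 \<le> r" "1 \<le> i" "i \<le> n + 1" "1 \<le> j"
  shows "int (D_upper n k r b p i j) =
    (int n - int i + 1) * int p + int b - int i + int j + int k + (int i - 1) * int r"
proof -
  have "i - 1 \<le> (i - 1) * r"
    using mult_le_mono2[OF assms(1), of "i - 1"] by (simp only: mult_1_right)
  then have "i \<le> (n + 1 - i) * p + b + j + k + (i - 1) * r"
    using assms(2,4) by linarith
  then show ?thesis
    using assms(2,3) unfolding D_upper_def by (simp add: of_nat_diff)
qed

text \<open>Matrices are indexed from 0 in the library, whence the shift of both indices.\<close>
definition D :: "nat \<Rightarrow> nat \<Rightarrow> nat \<Rightarrow> nat \<Rightarrow> nat \<Rightarrow> int" where
  "D n k r b p = det (mat (n + 1) (n + 1)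
     (\<lambda>(i, j). int (D_upper n k r b p (i + 1) (j + 1) choose (k + (i + 1 - 1) * r))))"

definition A_set :: "nat \<Rightarrow> nat \<Rightarrow> nat \<Rightarrow> (nat \<times> nat) set" where
  "A_set n k r = {(i, j). j \<le> n \<and> j < i \<and> i \<le> k + (r - 1) * (n - j)}"

definition B_set :: "nat \<Rightarrow> nat \<Rightarrow> nat \<Rightarrow> (nat \<times> nat) set" where
  "B_set n k r = {(i, j). 1 \<le> i \<and> 1 \<le> j \<and> i + j \<le> n + 1 \<and> (\<forall>s. i \<noteq> k + 1 + r * s)}"

lemma finite_A_set: "finite (A_set n k r)"
proof (rule finite_subset)
  show "A_set n k r \<subseteq> (\<Union>j\<in>{..n}. {..k + (r - 1) * (n - j)} \<times> {j})"
    by (auto simp: A_set_def)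
qed simp

lemma finite_B_set: "finite (B_set n k r)"
proof (rule finite_subset)
  show "B_set n k r \<subseteq> {..n + 1} \<times> {..n + 1}"
    by (auto simp: B_set_def)
qed simp

end

theory Submission
  imports Defs
begin

text \<open>
  Number rows and columns from \<open>0\<close> to \<open>n\<close>. Vandermonde convolution reduces the determinant to
  \<open>det (u\<^sub>i choose (c\<^sub>i - j))\<close> with \<open>c\<^sub>i = k + i r\<close> and \<open>u\<^sub>i = (n - i) p + b + k + i (r - 1)\<close>. Up to
  factorials that depend on the row only, the entry is \<open>P\<^sub>j(i)\<close> for a polynomial \<open>P\<^sub>j\<close> of degree \<open>n\<close>
  that is a product of two falling factorials of linear polynomials. By
  \<open>det (P\<^sub>j(x\<^sub>i)) = det (x\<^sub>i^l) det (coeff P\<^sub>j l)\<close>, replacing the points \<open>x\<^sub>i = i\<close> by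
  \<open>x\<^sub>i = (i - k) / r\<close> changes the determinant by a factor independent of \<open>p\<close> and \<open>b\<close>, and at
  the new points the matrix is triangular. So \<open>D n k r b p\<close> is an explicit product times a factor
  independent of \<open>p\<close> and \<open>b\<close>, which is found from \<open>D n k r 0 0 = 1\<close>.
\<close>

section \<open>Determinants\<close>

lemma det_scale_rows:
  fixes f :: "nat \<Rightarrow> 'a::comm_ring_1"
  shows "det (mat n n (\<lambda>(i, j). f i * M i j)) = (\<Prod>i<n. f i) * det (mat n n (\<lambda>(i, j). M i j))"
proof -
  have "mat n n (\<lambda>(i, j). f i * M i j) = mat_diag n f * mat n n (\<lambda>(i, j). M i j)"
    by (subst mat_diag_mult_left[of _ n n]) (auto intro!: eq_matI)
  moreover have "det (mat_diag n f) = (\<Prod>i<n. f i)"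
    by (subst det_lower_triangular[of n])
      (auto simp: mat_diag_def prod_list_diag_prod atLeast0LessThan)
  ultimately show ?thesis
    by (simp add: det_mult[of _ n])
qed

lemma det_poly_eval:
  fixes P :: "nat \<Rightarrow> 'a::comm_ring_1 poly"
  assumes deg: "\<And>j. j \<le> n \<Longrightarrow> degree (P j) \<le> n"
  shows "det (mat (Suc n) (Suc n) (\<lambda>(i, j). poly (P j) (x i))) =
    det (mat (Suc n) (Suc n) (\<lambda>(i, l). x i ^ l)) *
    det (mat (Suc n) (Suc n) (\<lambda>(l, j). coeff (P j) l))"
proof -
  have eval: "poly (P j) y = (\<Sum>l<Suc n. y ^ l * coeff (P j) l)" if "j \<le> n" for j y
  proof -
    have "poly (P j) y = poly (\<Sum>l\<le>n. monom (coeff (P j) l) l) y"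
      using poly_as_sum_of_monoms'[OF deg[OF that]] by simp
    then show ?thesis
      by (simp add: poly_sum poly_monom lessThan_Suc_atMost mult.commute
          del: lessThan_Suc sum.lessThan_Suc)
  qed
  have "mat (Suc n) (Suc n) (\<lambda>(i, j). poly (P j) (x i)) =
    mat (Suc n) (Suc n) (\<lambda>(i, l). x i ^ l) * mat (Suc n) (Suc n) (\<lambda>(l, j). coeff (P j) l)"
    by (rule eq_matI)
      (auto simp: scalar_prod_def eval atLeast0LessThan simp del: lessThan_Suc sum.lessThan_Suc)
  then show ?thesis
    by (simp add: det_mult[of _ "Suc n"])
qed

text \<open>Both sides are the product of the same two Vandermonde and two coefficient determinants.
  Cross-multiplying avoids dividing by a Vandermonde determinant.\<close>

lemma det_poly_eval_cross:
  fixes P Q :: "nat \<Rightarrow> 'a::comm_ring_1 poly"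
  assumes "\<And>j. j \<le> n \<Longrightarrow> degree (P j) \<le> n" "\<And>j. j \<le> n \<Longrightarrow> degree (Q j) \<le> n"
  shows "det (mat (Suc n) (Suc n) (\<lambda>(i, j). poly (P j) (x i))) *
      det (mat (Suc n) (Suc n) (\<lambda>(i, j). poly (Q j) (y i))) =
    det (mat (Suc n) (Suc n) (\<lambda>(i, j). poly (P j) (y i))) *
      det (mat (Suc n) (Suc n) (\<lambda>(i, j). poly (Q j) (x i)))"
  using assms by (simp add: det_poly_eval ac_simps)

text \<open>By Vandermonde convolution the matrix is a product whose right factor, with entries
  \<open>j choose l\<close>, is unitriangular. Without the guard, truncated subtraction would turn
  the entries with \<open>j > c i\<close> into \<open>u i choose 0 = 1\<close>.\<close>

lemma det_binomial_shift:
  "det (mat n n (\<lambda>(i, j). of_nat ((u i + j) choose c i))) =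
   (det (mat n n (\<lambda>(i, j). of_nat (if j \<le> c i then u i choose (c i - j) else 0))) :: 'a::idom)"
proof -
  have conv: "(\<Sum>l<n. (if l \<le> c' then u' choose (c' - l) else 0) * (j choose l)) = (u' + j) choose c'"
    if "j < n" for u' c' j
  proof -
    have "(\<Sum>l<n. (if l \<le> c' then u' choose (c' - l) else 0) * (j choose l))
        = (\<Sum>l\<in>{..j} \<inter> {..c'}. (j choose l) * (u' choose (c' - l)))"
      using that by (intro sum.mono_neutral_cong_right) auto
    also have "\<dots> = (\<Sum>l\<le>c'. (j choose l) * (u' choose (c' - l)))"
      by (intro sum.mono_neutral_left) auto
    finally show ?thesis
      by (simp add: vandermonde add.commute)
  qed
  let ?B = "mat n n (\<lambda>(i, j). of_nat (if j \<le> c i then u i choose (c i - j) else 0)) :: 'a mat"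
  let ?T = "mat n n (\<lambda>(l, j). of_nat (j choose l)) :: 'a mat"
  have "mat n n (\<lambda>(i, j). of_nat ((u i + j) choose c i)) = ?B * ?T"
    by (rule eq_matI)
      (auto simp: scalar_prod_def conv[symmetric] atLeast0LessThan intro!: sum.cong)
  moreover have "det ?T = 1"
    by (subst det_upper_triangular[of _ n])
      (auto simp: upper_triangular_def prod_list_diag_prod binomial_eq_0)
  ultimately show ?thesis
    by (simp add: det_mult[of _ n])
qed

section \<open>Reduction to a determinant of polynomial values\<close>

text \<open>For \<open>j > c\<close> both sides vanish; this covers the zero binomials below and
  later gives the triangular shape.\<close>

lemma prod_falling:
  "(\<Prod>l<j. of_nat c - of_nat l :: 'a::field_char_0) = fact j * of_nat (c choose j)"
  by (simp add: binomial_gbinomial gbinomial_prod_rev atLeast0LessThan)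

text \<open>Since \<open>u - (c - j) = e - (n - j)\<close>, the denominator of the binomial turns
  \<open>c!\<close> and \<open>e!\<close> into falling factorials. When the binomial vanishes, one
  of these contains the factor 0.\<close>

lemma binomial_shift_falling:
  assumes "u + n = c + e" "j \<le> n"
  shows "of_nat (if j \<le> c then u choose (c - j) else 0) * (fact c * fact e :: 'a::field_char_0) =
    fact u * ((\<Prod>l<j. of_nat c - of_nat l) * (\<Prod>l<n - j. of_nat e - of_nat l))"
proof (cases "j \<le> c \<and> c - j \<le> u")
  case True
  then have le: "j \<le> c" "c - j \<le> u" "n - j \<le> e" using assms by auto
  moreover have "e - (n - j) = u - (c - j)" using le assms by auto
  ultimately show ?thesis
    unfolding prod_falling by (simp add: binomial_fact)
next
  case False
  then have "j > c \<or> u < c - j \<and> n - j > e" using assms by auto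
  then show ?thesis
    unfolding prod_falling by (auto simp: binomial_eq_0)
qed

definition upper :: "nat \<Rightarrow> nat \<Rightarrow> nat \<Rightarrow> nat \<Rightarrow> nat \<Rightarrow> nat \<Rightarrow> nat" where
  "upper n k r b p i = (n - i) * p + b + k + (r - 1) * i"

text \<open>At the point \<open>i\<close> the two products are the falling factorials of
  \<open>k + i r\<close> and \<open>(n - i) (p + 1) + b\<close>, of lengths \<open>j\<close> and
  \<open>n - j\<close>.\<close>

definition lin_poly :: "nat \<Rightarrow> nat \<Rightarrow> nat \<Rightarrow> nat \<Rightarrow> nat \<Rightarrow> nat \<Rightarrow> rat poly" where
  "lin_poly n k r b p j =
     (\<Prod>l<j. [:of_nat k - of_nat l, of_nat r:]) *
     (\<Prod>l<n - j. [:of_nat (n * p + b + n) - of_nat l, - of_nat (p + 1):])"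

lemma degree_lin_poly: "j \<le> n \<Longrightarrow> degree (lin_poly n k r b p j) \<le> n"
proof -
  assume "j \<le> n"
  have lin: "degree (\<Prod>l<m. [:f l, a:]) \<le> m" for m and f :: "nat \<Rightarrow> rat" and a
    by (rule order_trans[OF degree_prod_sum_le])
      (auto intro: sum_bounded_above[of "{..<m}" _ 1, simplified])
  have "degree (lin_poly n k r b p j) \<le> j + (n - j)"
    unfolding lin_poly_def by (intro order_trans[OF degree_mult_le] add_mono lin)
  then show ?thesis
    using \<open>j \<le> n\<close> by simp
qed

lemma D_eq_det_poly:
  assumes "1 \<le> r"
  shows "of_int (D n k r b p) * (\<Prod>i\<le>n. fact (k + i * r) * fact ((n - i) * p + b + (n - i))) =
    (\<Prod>i\<le>n. fact (upper n k r b p i)) *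
      det (mat (Suc n) (Suc n) (\<lambda>(i, j). poly (lin_poly n k r b p j) (of_nat i)))"
proof -
  let ?u = "upper n k r b p" and ?c = "\<lambda>i. k + i * r" and ?e = "\<lambda>i. (n - i) * p + b + (n - i)"
  let ?B = "\<lambda>i j. of_nat (if j \<le> ?c i then ?u i choose (?c i - j) else 0) :: rat"
  obtain q where r: "r = Suc q"
    using assms by (cases r) auto
  have D: "of_int (D n k r b p) = det (mat (Suc n) (Suc n) (\<lambda>(i, j). ?B i j))"
  proof -
    have "D_upper n k r b p (i + 1) (j + 1) = ?u i + j" for i j
      by (simp add: r D_upper_def upper_def mult.commute)
    then have "of_int (D n k r b p) =
        det (map_mat (of_int :: int \<Rightarrow> rat)
          (mat (Suc n) (Suc n) (\<lambda>(i, j). int (?u i + j choose ?c i))))"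
      by (simp add: D_def)
    also have "map_mat (of_int :: int \<Rightarrow> rat)
          (mat (Suc n) (Suc n) (\<lambda>(i, j). int (?u i + j choose ?c i))) =
        mat (Suc n) (Suc n) (\<lambda>(i, j). of_nat (?u i + j choose ?c i))"
      by (rule eq_matI) auto
    finally show ?thesis
      by (simp only: det_binomial_shift)
  qed
  have entry: "(fact (?c i) * fact (?e i)) * ?B i j =
      fact (?u i) * poly (lin_poly n k r b p j) (of_nat i)" if "i \<le> n" "j \<le> n" for i j
  proof -
    have sum: "?u i + n = ?c i + ?e i"
      using that by (simp add: r upper_def mult.commute)
    have e: "(of_nat (?e i) :: rat) = of_nat (n * p + b + n) - of_nat (p + 1) * of_nat i"
      using le_Suc_ex[OF \<open>i \<le> n\<close>] by (auto simp: algebra_simps)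
    have "poly (lin_poly n k r b p j) (of_nat i) =
        (\<Prod>l<j. of_nat (?c i) - of_nat l) * (\<Prod>l<n - j. of_nat (?e i) - of_nat l)"
      unfolding e lin_poly_def by (simp add: poly_prod algebra_simps)
    then show ?thesis
      using binomial_shift_falling[OF sum \<open>j \<le> n\<close>, where 'a = rat]
      by (simp only: mult.commute)
  qed
  have "mat (Suc n) (Suc n) (\<lambda>(i, j). (fact (?c i) * fact (?e i)) * ?B i j) =
      mat (Suc n) (Suc n) (\<lambda>(i, j). fact (?u i) * poly (lin_poly n k r b p j) (of_nat i))"
    by (rule cong_mat) (use entry in auto)
  from arg_cong[OF this, of det] show ?thesis
    unfolding det_scale_rows D lessThan_Suc_atMost by (simp only: mult.commute)
qed

text \<open>With \<open>a = k + i (r - 1)\<close> the entry is \<open>j + a choose (i + a)\<close>,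
  which is 0 below the diagonal and 1 on it.\<close>

lemma D_zero:
  assumes "1 \<le> r"
  shows "D n k r 0 0 = 1"
proof -
  obtain q where r: "r = Suc q"
    using assms by (cases r) auto
  have up: "D_upper n k r 0 0 (i + 1) (j + 1) = j + (k + i * q)" for i j
    by (simp add: r D_upper_def)
  show ?thesis
    unfolding D_def up
    by (subst det_upper_triangular[of _ "n + 1"])
      (auto simp: r upper_triangular_def prod_list_diag_prod binomial_eq_0 add.left_commute[of k])
qed

section \<open>The triangular evaluation\<close>

text \<open>The subtraction is rational because \<open>i\<close> may exceed \<open>k + 1\<close>. At
  \<open>p = b = 0\<close> this is the denominator of the same factor.\<close>

definition num_B :: "nat \<Rightarrow> nat \<Rightarrow> nat \<Rightarrow> nat \<Rightarrow> nat \<Rightarrow> nat \<Rightarrow> nat \<Rightarrow> rat" where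
  "num_B n k r b p i j = (of_nat k - of_nat i + 1) * (of_nat p + 1) +
     (of_nat i + of_nat j - 1) * of_nat r + of_nat r * (of_nat b + of_nat n * of_nat p)"

definition triangle :: "nat \<Rightarrow> (nat \<times> nat) set" where
  "triangle n = {(i, j). 1 \<le> i \<and> 1 \<le> j \<and> i + j \<le> n + 1}"

lemma finite_triangle: "finite (triangle n)"
  by (rule finite_subset[of _ "{..n} \<times> {..n}"]) (auto simp: triangle_def)

lemma prod_triangle:
  "(\<Prod>i\<le>n. \<Prod>l<n - i. h (i + 1) (n - l - i)) = (\<Prod>(i, j)\<in>triangle n. h i j)"
proof -
  have "(\<Prod>i\<le>n. \<Prod>l<n - i. h (i + 1) (n - l - i)) =
      (\<Prod>(i, l)\<in>Sigma {..n} (\<lambda>i. {..<n - i}). h (i + 1) (n - l - i))"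
    by (rule prod.Sigma) auto
  also have "\<dots> = (\<Prod>(i, j)\<in>triangle n. h i j)"
    by (rule prod.reindex_bij_witness[of _ "\<lambda>(i, j). (i - 1, n + 1 - i - j)"
          "\<lambda>(i, l). (i + 1, n - l - i)"])
      (auto simp: triangle_def)
  finally show ?thesis .
qed

text \<open>The points solve \<open>k + r x = i\<close>, so the first product in
  \<open>lin_poly\<close> becomes the falling factorial of \<open>i\<close> of length
  \<open>j\<close>, which is 0 for \<open>i < j\<close>.\<close>

lemma det_lin_poly_triangular:
  assumes "1 \<le> r"
  shows "det (mat (Suc n) (Suc n)
      (\<lambda>(i, j). poly (lin_poly n k r b p j) ((of_nat i - of_nat k) / of_nat r))) =
    (\<Prod>i\<le>n. fact i) / of_nat r ^ card (triangle n) * (\<Prod>(i, j)\<in>triangle n. num_B n k r b p i j)"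
proof -
  have eval: "poly (lin_poly n k r b p j) ((of_nat i - of_nat k) / of_nat r) =
      (\<Prod>l<j. of_nat i - of_nat l) *
      (\<Prod>l<n - j. of_nat (n * p + b + n) - of_nat l - of_nat (p + 1) * (of_nat i - of_nat k) / of_nat r)"
    for i j
    using assms by (simp add: lin_poly_def poly_prod field_simps)
  have lower: "poly (lin_poly n k r b p j) ((of_nat i - of_nat k) / of_nat r) = 0"
    if "i < j" for i j
    unfolding eval prod_falling using that by (simp add: binomial_eq_0)
  have diag: "poly (lin_poly n k r b p i) ((of_nat i - of_nat k) / of_nat r) =
      fact i * (\<Prod>l<n - i. num_B n k r b p (i + 1) (n - l - i) / of_nat r)" for i
  proof -
    have "(\<Prod>l<n - i. of_nat (n * p + b + n) - of_nat l - of_nat (p + 1) * (of_nat i - of_nat k) / of_nat r)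
        = (\<Prod>l<n - i. num_B n k r b p (i + 1) (n - l - i) / of_nat r)"
      using assms by (intro prod.cong refl) (simp add: num_B_def of_nat_diff field_simps)
    then show ?thesis
      unfolding eval prod_falling by simp
  qed
  have "det (mat (Suc n) (Suc n)
      (\<lambda>(i, j). poly (lin_poly n k r b p j) ((of_nat i - of_nat k) / of_nat r))) =
    (\<Prod>i\<le>n. poly (lin_poly n k r b p i) ((of_nat i - of_nat k) / of_nat r))"
    by (subst det_lower_triangular[of "Suc n"])
      (auto simp: lower prod_list_diag_prod atLeast0LessThan lessThan_Suc_atMost
        simp del: lessThan_Suc prod.lessThan_Suc prod.op_ivl_Suc)
  also have "\<dots> = (\<Prod>i\<le>n. fact i) *
      (\<Prod>(i, j)\<in>triangle n. num_B n k r b p i j / of_nat r)"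
    unfolding diag prod.distrib prod_triangle[of "\<lambda>i j. num_B n k r b p i j / of_nat r"] ..
  also have "(\<Prod>(i, j)\<in>triangle n. num_B n k r b p i j / of_nat r) =
      (\<Prod>(i, j)\<in>triangle n. num_B n k r b p i j) / of_nat r ^ card (triangle n)"
    by (simp add: prod_dividef case_prod_unfold)
  finally show ?thesis
    by simp
qed

section \<open>Index sets\<close>

lemma prod_A_set:
  "(\<Prod>(i, j)\<in>A_set n k r. h i j) = (\<Prod>m\<le>n. \<Prod>t\<in>{m<..k + (r - 1) * (n - m)}. h t m)"
proof -
  have "(\<Prod>m\<le>n. \<Prod>t\<in>{m<..k + (r - 1) * (n - m)}. h t m) =
      (\<Prod>(m, t)\<in>Sigma {..n} (\<lambda>m. {m<..k + (r - 1) * (n - m)}). h t m)"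
    by (rule prod.Sigma) auto
  also have "\<dots> = (\<Prod>(i, j)\<in>A_set n k r. h i j)"
    by (rule prod.reindex_bij_witness[of _ "\<lambda>(i, j). (j, i)" "\<lambda>(i, j). (j, i)"])
      (auto simp: A_set_def)
  finally show ?thesis ..
qed

lemma B_set_subset_triangle: "B_set n k r \<subseteq> triangle n"
  by (auto simp: B_set_def triangle_def)

text \<open>
  The pairs left out in \<open>B_set\<close> are those with \<open>i = k + 1 + r s\<close>; put \<open>m = n - s\<close> and
  \<open>t = i + j - 1 - s\<close>. Then \<open>num_B\<close> equals \<open>r (t + b + m p)\<close>, and \<open>t\<close> runs over the factors by
  which \<open>(m p + b + m)!\<close> exceeds \<open>(m p + b + k + (r - 1) (n - m))!\<close>.
\<close>
lemma prod_triangle_diff_B_set: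
  assumes "1 \<le> r"
  shows "(\<Prod>(i, j)\<in>triangle n - B_set n k r. num_B n k r b p i j) =
    of_nat r ^ card (triangle n - B_set n k r) *
    (\<Prod>m\<le>n. \<Prod>t\<in>{k + (r - 1) * (n - m)<..m}. of_nat t + of_nat b + of_nat m * of_nat p)"
proof -
  \<comment> \<open>In the new coordinates \<open>j \<ge> 1\<close> reads
    \<open>t > k + (r - 1) (n - m)\<close>, and \<open>i + j \<le> n + 1\<close> reads
    \<open>t \<le> m\<close>.\<close>
  define S where "S = Sigma {..n} (\<lambda>m. {k + (r - 1) * (n - m)<..m})"
  define f where "f = (\<lambda>(m, t). (k + 1 + r * (n - m), t - (k + (r - 1) * (n - m))))"
  obtain q where r: "r = Suc q"
    using assms by (cases r) auto
  have S: "(m, t) \<in> S \<longleftrightarrow> m \<le> n \<and> k + q * (n - m) < t \<and> t \<le> m" for m t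
    by (auto simp: S_def r)
  have "inj_on f S"
  proof (rule inj_onI)
    fix x y assume "x \<in> S" "y \<in> S" and eq: "f x = f y"
    then obtain m t m' t' where xy: "x = (m, t)" "y = (m', t')"
      and mt: "m \<le> n" "k + q * (n - m) < t" "m' \<le> n" "k + q * (n - m') < t'"
      by (metis S surj_pair)
    have "n - m = n - m'"
      using eq by (simp add: xy f_def r flip: mult_Suc)
    with mt have "m = m'" by arith
    with eq mt show "x = y" by (simp add: xy f_def r)
  qed
  moreover have "f ` S = triangle n - B_set n k r"
  proof (intro equalityI subsetI)
    fix x assume "x \<in> f ` S"
    then obtain m t where x: "x = f (m, t)" and "(m, t) \<in> S" by auto
    moreover obtain s where "n = m + s"
      using calculation by (auto simp: S dest: le_Suc_ex)
    ultimately show "x \<in> triangle n - B_set n k r"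
      by (auto simp: S f_def triangle_def B_set_def r)
  next
    fix x assume "x \<in> triangle n - B_set n k r"
    moreover obtain i j where x: "x = (i, j)" by (cases x)
    ultimately have ij: "1 \<le> j" "i + j \<le> n + 1" and "\<exists>s. i = k + 1 + r * s"
      unfolding triangle_def B_set_def by blast+
    then obtain s where i: "i = k + 1 + r * s" by blast
    have "x = f (n - s, k + q * s + j)" "(n - s, k + q * s + j) \<in> S"
      using ij by (auto simp: x i f_def S r)
    then show "x \<in> f ` S" by blast
  qed
  ultimately have bij: "bij_betw f S (triangle n - B_set n k r)"
    by (simp add: bij_betw_def)
  have val: "case_prod (num_B n k r b p) (f x) =
      of_nat r * (case x of (m, t) \<Rightarrow> of_nat t + of_nat b + of_nat m * of_nat p)" if "x \<in> S" for x
  proof -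
    obtain m t where x: "x = (m, t)" by (cases x)
    define s where "s = n - m"
    have n: "n = m + s" and t: "k + q * s < t"
      using that by (auto simp: x S s_def)
    show ?thesis
      using t by (simp add: x f_def num_B_def r n of_nat_diff algebra_simps)
  qed
  have "(\<Prod>x\<in>triangle n - B_set n k r. case_prod (num_B n k r b p) x) =
      (\<Prod>x\<in>S. of_nat r * (case x of (m, t) \<Rightarrow> of_nat t + of_nat b + of_nat m * of_nat p))"
    by (simp add: prod.reindex_bij_betw[OF bij, symmetric] val cong: prod.cong)
  also have "\<dots> = of_nat r ^ card (triangle n - B_set n k r) *
      (\<Prod>(m, t)\<in>S. of_nat t + of_nat b + of_nat m * of_nat p)"
    by (simp add: prod.distrib bij_betw_same_card[OF bij])
  also have "(\<Prod>(m, t)\<in>S. of_nat t + of_nat b + of_nat m * of_nat p) =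
      (\<Prod>m\<le>n. \<Prod>t\<in>{k + (r - 1) * (n - m)<..m}. of_nat t + of_nat b + of_nat m * of_nat p :: rat)"
    unfolding S_def by (rule prod.Sigma[symmetric]) auto
  finally show ?thesis .
qed

text \<open>Both sides are the factorial of \<open>x + max a m\<close>, one of the two intervals
  being empty. So no case distinction on \<open>a\<close> and \<open>m\<close> is left to the
  user.\<close>

lemma fact_mult_prod_interval:
  "fact (x + a) * (\<Prod>t\<in>{a<..m}. of_nat t + of_nat x) =
   (fact (x + m) * (\<Prod>t\<in>{m<..a}. of_nat t + of_nat x) :: 'a::{comm_semiring_1,semiring_char_0})"
proof -
  have up: "fact (x + a) * (\<Prod>t\<in>{a<..a + d}. of_nat t + of_nat x) = (fact (x + (a + d)) :: 'a)" for a d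
  proof (induction d)
    case (Suc d)
    have "{a<..a + Suc d} = insert (a + Suc d) {a<..a + d}" by auto
    then show ?case
      using Suc.IH by (simp add: algebra_simps)
  qed simp
  show ?thesis
  proof (cases "a \<le> m")
    case True
    then show ?thesis using up[of a "m - a"] by simp
  next
    case False
    then show ?thesis using up[of m "a - m"] by simp
  qed
qed

text \<open>The numerators of the claimed product; at \<open>p = b = 0\<close> they become its
  denominators.\<close>

definition prod_AB :: "nat \<Rightarrow> nat \<Rightarrow> nat \<Rightarrow> nat \<Rightarrow> nat \<Rightarrow> rat" where
  "prod_AB n k r b p = (\<Prod>(i, j)\<in>A_set n k r. of_nat i + of_nat b + of_nat j * of_nat p) *
     (\<Prod>(i, j)\<in>B_set n k r. num_B n k r b p i j)"

text \<open>For each \<open>m = n - i\<close>, \<open>fact_mult_prod_interval\<close> with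
  \<open>x = m p + b\<close> trades the pairs outside \<open>B_set\<close> for the factors of
  \<open>A_set\<close> in column \<open>m\<close>.\<close>

lemma fact_mult_prod_triangle:
  assumes "1 \<le> r"
  shows "(\<Prod>i\<le>n. fact (upper n k r b p i)) * (\<Prod>(i, j)\<in>triangle n. num_B n k r b p i j) =
    of_nat r ^ card (triangle n - B_set n k r) * prod_AB n k r b p *
    (\<Prod>i\<le>n. fact ((n - i) * p + b + (n - i)))"
proof -
  let ?a = "\<lambda>m. k + (r - 1) * (n - m)"
  let ?h = "\<lambda>t m. of_nat t + of_nat b + of_nat m * of_nat p :: rat"
  have rev: "(\<Prod>i\<le>n. g i) = (\<Prod>m\<le>n. g (n - m))" for g :: "nat \<Rightarrow> rat"
    by (rule prod.reindex_bij_witness[of _ "\<lambda>i. n - i" "\<lambda>i. n - i"]) auto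
  have "(\<Prod>i\<le>n. fact (upper n k r b p i)) * (\<Prod>m\<le>n. \<Prod>t\<in>{?a m<..m}. ?h t m) =
      (\<Prod>m\<le>n. fact (m * p + b + ?a m) * (\<Prod>t\<in>{?a m<..m}. of_nat t + of_nat (m * p + b)))"
    by (subst rev) (simp add: upper_def prod.distrib algebra_simps)
  also have "\<dots> = (\<Prod>m\<le>n. fact (m * p + b + m) * (\<Prod>t\<in>{m<..?a m}. of_nat t + of_nat (m * p + b)))"
    by (simp only: fact_mult_prod_interval)
  also have "\<dots> = (\<Prod>i\<le>n. fact ((n - i) * p + b + (n - i))) * (\<Prod>(i, j)\<in>A_set n k r. ?h i j)"
    unfolding prod_A_set by (subst (2) rev) (simp add: prod.distrib algebra_simps)
  finally have A: "(\<Prod>i\<le>n. fact (upper n k r b p i)) * (\<Prod>m\<le>n. \<Prod>t\<in>{?a m<..m}. ?h t m) =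
      (\<Prod>i\<le>n. fact ((n - i) * p + b + (n - i))) * (\<Prod>(i, j)\<in>A_set n k r. ?h i j)" .
  have T: "(\<Prod>(i, j)\<in>triangle n. num_B n k r b p i j) =
      (\<Prod>(i, j)\<in>triangle n - B_set n k r. num_B n k r b p i j) *
      (\<Prod>(i, j)\<in>B_set n k r. num_B n k r b p i j)"
    by (rule prod.subset_diff[OF B_set_subset_triangle finite_triangle])
  have "U * (R * E * B) = R * (A * B) * V" if "U * E = V * A" for U R E A B V :: rat
    using arg_cong[OF that, of "\<lambda>x. R * x * B"] by (simp add: ac_simps)
  from this[OF A] show ?thesis
    unfolding prod_AB_def T prod_triangle_diff_B_set[OF assms] .
qed

section \<open>Nonvanishing at \<open>p = b = 0\<close> and determination of the constant\<close>

lemma num_B_zero_pos: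
  assumes "(i, j) \<in> B_set n k r" "1 \<le> r"
  shows "num_B n k r 0 0 i j > 0"
proof -
  obtain i' j' r' where "i = Suc i'" "j = Suc j'" "r = Suc r'"
    using assms by (cases i; cases j; cases r) (auto simp: B_set_def)
  \<comment> \<open>The term \<open>- i'\<close> is absorbed by \<open>i' r\<close>, leaving a
    natural number that is at least \<open>r\<close>.\<close>
  then have "num_B n k r 0 0 i j = of_nat (k + i' * r' + j' * r + r)"
    by (simp add: num_B_def algebra_simps)
  then show ?thesis
    using assms(2) by (simp only: of_nat_0_less_iff)
qed

lemma prod_AB_zero_nonzero: "1 \<le> r \<Longrightarrow> prod_AB n k r 0 0 \<noteq> 0"
  unfolding prod_AB_def
  by (auto simp: finite_A_set finite_B_set) (auto simp: A_set_def dest: num_B_zero_pos)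

lemma D_eq_prod_AB_quotient:
  assumes "1 \<le> r"
  shows "of_int (D n k r b p) = prod_AB n k r b p / prod_AB n k r 0 0"
proof -
  define d where "d b p = det (mat (Suc n) (Suc n)
      (\<lambda>(i, j). poly (lin_poly n k r b p j) (of_nat i)))" for b p
  define u where "u b p = (\<Prod>i\<le>n. fact (upper n k r b p i) :: rat)" for b p
  define e where "e b p = (\<Prod>i\<le>n. fact ((n - i) * p + b + (n - i)) :: rat)" for b p
  define N where "N b p = (\<Prod>(i, j)\<in>triangle n. num_B n k r b p i j)" for b p
  define c where "c = (\<Prod>i\<le>n. fact (k + i * r) :: rat)"
  define R where "R = (of_nat r ^ card (triangle n - B_set n k r) :: rat)"
  define w where "w = (\<Prod>i\<le>n. fact i) / (of_nat r ^ card (triangle n) :: rat)"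
  have nz: "R \<noteq> 0" "w \<noteq> 0" "c \<noteq> 0" "u b p \<noteq> 0" "e b p \<noteq> 0" for b p
    using assms by (auto simp: R_def w_def c_def u_def e_def)
  have 1: "of_int (D n k r b p) * (c * e b p) = u b p * d b p" for b p
    using D_eq_det_poly[OF assms] by (simp add: c_def e_def u_def d_def prod.distrib)
  have 2: "u b p * N b p = R * prod_AB n k r b p * e b p" for b p
    using fact_mult_prod_triangle[OF assms] by (simp add: u_def N_def R_def e_def)
  \<comment> \<open>The values at the two point sets differ by a ratio of Vandermonde determinants,
    the same for \<open>(b, p)\<close> and \<open>(0, 0)\<close>.\<close>
  have "d b p * (w * N 0 0) = w * N b p * d 0 0"
    using det_poly_eval_cross[of n "lin_poly n k r b p" "lin_poly n k r 0 0" of_nat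
        "\<lambda>i. (of_nat i - of_nat k) / of_nat r", OF degree_lin_poly degree_lin_poly]
    unfolding det_lin_poly_triangular[OF assms] by (simp add: d_def w_def N_def)
  then have 3: "d b p * N 0 0 = N b p * d 0 0"
    using nz(2) by simp
  have 4: "c * e 0 0 = u 0 0 * d 0 0"
    using 1[of 0 0] D_zero[OF assms] by simp
  have F0: "prod_AB n k r 0 0 \<noteq> 0"
    by (rule prod_AB_zero_nonzero[OF assms])
  \<comment> \<open>As \<open>D n k r 0 0 = 1\<close>, the determinant \<open>d 0 0\<close> is a
    quotient of factorial products, so it can be cancelled at the end.\<close>
  have d0: "d 0 0 \<noteq> 0"
    using 4 nz by auto
  have "c * e 0 0 * N 0 0 = R * prod_AB n k r 0 0 * e 0 0 * d 0 0"
    unfolding 4 2[symmetric] by simp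
  then have c: "c * N 0 0 = R * prod_AB n k r 0 0 * d 0 0"
    using nz(5)[of 0 0] by simp
  have "of_int (D n k r b p) * (c * N 0 0) * e b p = R * prod_AB n k r b p * d 0 0 * e b p"
  proof -
    have "of_int (D n k r b p) * (c * N 0 0) * e b p = u b p * (d b p * N 0 0)"
      using 1[of b p] by (simp add: ac_simps)
    also have "\<dots> = u b p * N b p * d 0 0"
      by (simp add: 3)
    finally show ?thesis
      unfolding 2 by (simp only: ac_simps)
  qed
  then have "of_int (D n k r b p) * prod_AB n k r 0 0 = prod_AB n k r b p"
    unfolding c using nz(1) nz(5)[of b p] d0 by simp
  then show ?thesis
    using F0 by (simp add: field_simps)
qed

theorem theorem5p9:
  fixes n k r p b :: nat
  assumes "1 \<le> n" and "1 \<le> k" and "1 \<le> r" and "r \<le> p + 1"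
  shows "(of_int (D n k r b p) :: rat) =
    (\<Prod>(i, j)\<in>A_set n k r. (of_nat i + of_nat b + of_nat j * of_nat p) / of_nat i) *
    (\<Prod>(i, j)\<in>B_set n k r.
       ((of_nat k - of_nat i + 1) * (of_nat p + 1) + (of_nat i + of_nat j - 1) * of_nat r
          + of_nat r * (of_nat b + of_nat n * of_nat p))
       / (of_nat k - of_nat i + 1 + (of_nat i + of_nat j - 1) * of_nat r))"
  unfolding D_eq_prod_AB_quotient[OF \<open>1 \<le> r\<close>] prod_AB_def
  by (simp add: num_B_def case_prod_unfold prod_dividef)

end
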